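(* For almost every triangle $T$ there is an $\varepsilon>0$ such that $$h(n,T,\varepsilon)\le 0.25108\binom n3(1+o(1))\qquad (n\to\infty).$$
   Context: A triangle with angles $\alpha',\beta',\gamma'$ is called $\varepsilon$-similar to a triangle $T$ with angles $\alpha,\beta,\gamma$ if, for a suitable labelling of its angles, $|\alpha-\alpha'|<\varepsilon$, $|\beta-\beta'|<\varepsilon$ and $|\gamma-\gamma'|<\varepsilon$. Here $\varepsilon>0$ is an angle smaller than any angle of $T$. $h(n,T,\varepsilon)$ denotes the maximal number of triangles (3-element subsets) in a set of $n$ points in the plane that are $\varepsilon$-similar to $T$. Triangle shapes are identified with the points of $S=\{(\alpha,\beta,\gamma):\alpha+\beta+\gamma=\pi,\ \alpha\ge\beta\ge\gamma>0\}$, a subset of a plane in $\mathbb R^3$; "almost every triangle" means all shapes in $S$ outside a set of two-dimensional Lebesgue measure zero. *)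

theory Defs
  imports "HOL-Analysis.Analysis" "HOL-Library.Landau_Symbols"
begin

definition triangle_shapes :: "(real \<times> real \<times> real) set" where
  "triangle_shapes =
     {(\<alpha>, \<beta>, \<gamma>). \<alpha> + \<beta> + \<gamma> = pi \<and> \<alpha> \<ge> \<beta> \<and> \<beta> \<ge> \<gamma> \<and> \<gamma> > 0}"

text \<open>Isometric coordinates on the plane \<open>\<alpha> + \<beta> + \<gamma> = pi\<close> in three-space, with origin at
  the equilateral shape; along them two-dimensional Lebesgue measure is transported to the plane.\<close>

definition shape_chart :: "real \<times> real \<Rightarrow> real \<times> real \<times> real" where
  "shape_chart = (\<lambda>(u, v). (pi / 3 + u / sqrt 2 + v / sqrt 6,
                            pi / 3 - u / sqrt 2 + v / sqrt 6,
                            pi / 3 - 2 * v / sqrt 6))"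

definition shape_measure :: "(real \<times> real \<times> real) measure" where
  "shape_measure = embed_measure lebesgue shape_chart"

lemma dist_shape_chart: "dist (shape_chart p) (shape_chart q) = dist p q"
proof -
  obtain a b c d where [simp]: "p = (a, b)" "q = (c, d)" by fastforce
  have s: "(sqrt 6)\<^sup>2 = 6" "(sqrt 2)\<^sup>2 = 2" by auto
  define x y where "x = (a - c) / sqrt 2" and "y = (b - d) / sqrt 6"
  have xy: "2 * x\<^sup>2 = (a - c)\<^sup>2" "6 * y\<^sup>2 = (b - d)\<^sup>2"
    by (simp_all add: x_def y_def power_divide s)
  have "(pi / 3 + a / sqrt 2 + b / sqrt 6) - (pi / 3 + c / sqrt 2 + d / sqrt 6) = x + y"
    "(pi / 3 - a / sqrt 2 + b / sqrt 6) - (pi / 3 - c / sqrt 2 + d / sqrt 6) = y - x"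
    "(pi / 3 - 2 * b / sqrt 6) - (pi / 3 - 2 * d / sqrt 6) = - (2 * y)"
    by (simp_all add: x_def y_def diff_divide_distrib right_diff_distrib)
  then have "(dist (shape_chart p) (shape_chart q))\<^sup>2 = (x + y)\<^sup>2 + ((y - x)\<^sup>2 + (2 * y)\<^sup>2)"
    by (simp only: shape_chart_def dist_prod_def dist_real_def \<open>p = (a, b)\<close> \<open>q = (c, d)\<close>
        prod.case fst_conv snd_conv power2_abs power2_minus real_sqrt_pow2
        sum_power2_ge_zero add_nonneg_nonneg zero_le_power2)
  also have "\<dots> = 2 * x\<^sup>2 + 6 * y\<^sup>2"
    by (simp add: power2_eq_square algebra_simps)
  also have "\<dots> = (dist p q)\<^sup>2"
    by (simp add: xy dist_prod_def dist_real_def)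
  finally show ?thesis by simp
qed

lemma inj_shape_chart: "inj shape_chart"
  by (metis dist_shape_chart dist_eq_0_iff injI)

lemma range_shape_chart: "range shape_chart = {(\<alpha>, \<beta>, \<gamma>). \<alpha> + \<beta> + \<gamma> = pi}"
proof (intro equalityI subsetI)
  fix t assume "t \<in> {(\<alpha>::real, \<beta>, \<gamma>). \<alpha> + \<beta> + \<gamma> = pi}"
  then obtain \<beta> \<gamma> where t: "t = (pi - \<beta> - \<gamma>, \<beta>, \<gamma>)"
    by (cases t) (auto simp: eq_diff_eq add.assoc add.commute add.left_commute)
  have "t = shape_chart (sqrt 2 * (pi - 2 * \<beta> - \<gamma>) / 2, sqrt 6 * (pi / 3 - \<gamma>) / 2)"
    by (simp add: t shape_chart_def field_simps)
  then show "t \<in> range shape_chart" by blast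
qed (auto simp: shape_chart_def)

definition angle_at :: "real ^ 2 \<Rightarrow> real ^ 2 \<Rightarrow> real ^ 2 \<Rightarrow> real" where
  "angle_at a b c = arccos (((b - a) \<bullet> (c - a)) / (norm (b - a) * norm (c - a)))"

text \<open>The labelling of the angles is the choice of the names \<open>a\<close>, \<open>b\<close>, \<open>c\<close> for the vertices.
  A non-collinear triple consists of three distinct points.\<close>

definition eps_similar :: "(real ^ 2) set \<Rightarrow> real \<times> real \<times> real \<Rightarrow> real \<Rightarrow> bool" where
  "eps_similar \<Delta> T \<epsilon> \<longleftrightarrow>
     (case T of (\<alpha>, \<beta>, \<gamma>) \<Rightarrow>
       \<exists>a b c. \<Delta> = {a, b, c} \<and> \<not> collinear {a, b, c} \<and>
         \<bar>\<alpha> - angle_at a b c\<bar> < \<epsilon> \<and> \<bar>\<beta> - angle_at b c a\<bar> < \<epsilon> \<and> \<bar>\<gamma> - angle_at c a b\<bar> < \<epsilon>)"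

definition num_similar :: "(real ^ 2) set \<Rightarrow> real \<times> real \<times> real \<Rightarrow> real \<Rightarrow> nat" where
  "num_similar P T \<epsilon> = card {\<Delta>. \<Delta> \<subseteq> P \<and> card \<Delta> = 3 \<and> eps_similar \<Delta> T \<epsilon>}"

definition h :: "nat \<Rightarrow> real \<times> real \<times> real \<Rightarrow> real \<Rightarrow> nat" where
  "h n T \<epsilon> = Max {num_similar P T \<epsilon> | P. finite P \<and> card P = n}"

lemma num_similar_le: "finite P \<Longrightarrow> num_similar P T \<epsilon> \<le> card P choose 3"
proof -
  assume "finite P"
  then have "num_similar P T \<epsilon> \<le> card {\<Delta>. \<Delta> \<subseteq> P \<and> card \<Delta> = 3}"
    unfolding num_similar_def by (intro card_mono) auto
  with \<open>finite P\<close> show ?thesis by (simp add: n_subsets)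
qed

text \<open>The maximum defining \<open>h\<close> ranges over a finite nonempty set.\<close>

lemma h_attained: "\<exists>P. finite P \<and> card P = n \<and> num_similar P T \<epsilon> = h n T \<epsilon>"
  and h_upper: "finite P \<Longrightarrow> card P = n \<Longrightarrow> num_similar P T \<epsilon> \<le> h n T \<epsilon>"
proof -
  let ?V = "{num_similar P T \<epsilon> | P. finite P \<and> card P = n}"
  have "?V \<subseteq> {..n choose 3}" using num_similar_le[of _ T \<epsilon>] by blast
  then have fin: "finite ?V" using finite_subset by blast
  have "infinite (UNIV :: (real ^ 2) set)"
    using infinite_UNIV_char_0 by (metis finite_imp_bounded not_bounded_UNIV)
  then obtain P0 :: "(real ^ 2) set" where "finite P0" "card P0 = n"
    using infinite_arbitrarily_large by blast
  then have "?V \<noteq> {}" by blast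
  from Max_in[OF fin this] show "\<exists>P. finite P \<and> card P = n \<and> num_similar P T \<epsilon> = h n T \<epsilon>"
    by (auto simp: h_def)
  show "finite P \<Longrightarrow> card P = n \<Longrightarrow> num_similar P T \<epsilon> \<le> h n T \<epsilon>"
    unfolding h_def using fin by (intro Max_ge) auto
qed

end

theory Submission
  imports Defs "HOL-Complex_Analysis.Complex_Analysis" "Jordan_Normal_Form.Determinant"
    "HOL-Library.Function_Algebras"
begin

text \<open>
For almost every shape, and \<open>\<epsilon>\<close> small in terms of the shape and of \<open>k\<close>, any set \<open>Q\<close> of at least two and at
most \<open>k\<close> points has a nonconstant colouring by the field of three elements whose sum over the vertices of each triangle that is
\<open>\<epsilon>\<close>-similar to the shape is zero (lemma \<open>generic_shape_colouring\<close>). Three colours with zero sum are equal or all different, so the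
triangles are transversal to the three colour classes or lie inside one class. By induction the number of triangles is at
most \<open>card Q ^ 3 / 24\<close> (lemma \<open>num_triples_le_cube\<close>), the bound attained in the limit by iterated balanced tripartite
systems. Averaging over the subsets of size \<open>1000\<close> then bounds the density in every larger set
(lemma \<open>num_triples_averaging\<close>).

The colouring comes from comparing two systems of linear equations. In the complex plane the vertices of a
triangle with prescribed angles satisfy a linear relation (lemma \<open>triangle_vertex_relation\<close>). As the shape
degenerates to a segment with its midpoint, the suitably scaled coefficients tend to \<open>1, 1, -2\<close>, and these are congruent modulo
three: the relations turn into the equations of a colouring. If these had only constant solutions, some determinant formed
from the relations would be nonzero modulo three in the degenerate limit. As an analytic function of the shape it would then be
nonzero for almost every shape, and by continuity also when the shapes of the triangles vary by less than \<open>\<epsilon>\<close>. But the relations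
have a nonconstant solution, namely the positions of the points, so the determinant vanishes.
\<close>

section \<open>The field with three elements and left inverses\<close>

datatype f3 = F0 | F1 | F2

instantiation f3 :: field
begin
definition zero_f3 where "0 = F0"
definition one_f3 where "1 = F1"
fun plus_f3 where
  "F0 + x = (x :: f3)" | "F1 + F0 = F1" | "F1 + F1 = F2" | "F1 + F2 = F0"
| "F2 + F0 = F2" | "F2 + F1 = F0" | "F2 + F2 = F1"
fun uminus_f3 where "- F0 = F0" | "- F1 = F2" | "- F2 = F1"
definition minus_f3 where "x - y = x + - (y :: f3)"
fun times_f3 where
  "F0 * x = F0" | "F1 * x = (x :: f3)" | "F2 * x = - x"
definition inverse_f3 where "inverse x = (x :: f3)"
definition divide_f3 where "x div y = x * (y :: f3)"

instance
proof
  fix a b c :: f3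
  note defs = zero_f3_def one_f3_def minus_f3_def inverse_f3_def divide_f3_def
  show "a * b * c = a * (b * c)" by (cases a; cases b; cases c) (simp_all add: defs)
  show "a * b = b * a" by (cases a; cases b) (simp_all add: defs)
  show "1 * a = a" by (simp add: defs)
  show "a + b + c = a + (b + c)" by (cases a; cases b; cases c) (simp_all add: defs)
  show "a + b = b + a" by (cases a; cases b) (simp_all add: defs)
  show "0 + a = a" by (simp add: defs)
  show "- a + a = 0" by (cases a) (simp_all add: defs)
  show "a - b = a + - b" by (simp add: defs)
  show "(a + b) * c = a * c + b * c" by (cases a; cases b; cases c) (simp_all add: defs)
  show "(0 :: f3) \<noteq> 1" by (simp add: defs)
  show "a \<noteq> 0 \<Longrightarrow> inverse a * a = 1" by (cases a) (simp_all add: defs)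
  show "a div b = a * inverse b" by (simp add: defs)
  show "inverse (0 :: f3) = 0" by (simp add: defs)
qed
end

lemma f3_int_lift: "\<exists>z :: int. of_int z = (x :: f3)"
proof (cases x)
  case F0 then show ?thesis by (intro exI[of _ 0]) (simp add: zero_f3_def)
next
  case F1 then show ?thesis by (intro exI[of _ 1]) (simp add: one_f3_def)
next
  case F2 then show ?thesis by (intro exI[of _ "-1"]) (simp add: one_f3_def)
qed

text \<open>The reason for characteristic three: the vertex weights \<open>1, 1, -2\<close> of a degenerate triangle, whose third
vertex is the midpoint of the other two, become equal, so they no longer remember which vertex carries which angle.\<close>

lemma f3_minus_two: "(-2 :: f3) = 1"
proof -
  have "(2 :: f3) = 1 + 1" by simp
  also have "\<dots> = - 1" by (simp add: one_f3_def del: one_add_one)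
  finally show ?thesis by simp
qed

text \<open>This is what turns a linear condition into a partition: a triple with zero sum has a single colour or
meets each colour class exactly once.\<close>

lemma f3_sum_zero_cases:
  fixes x y z :: f3
  assumes "x + y + z = 0"
  shows "(x = y \<and> y = z) \<or> {x, y, z} = {F0, F1, F2}"
  using assms by (cases x; cases y; cases z) (auto simp: zero_f3_def)

lemma sum_fun_eval: "(\<Sum>e\<in>E. f e) i = (\<Sum>e\<in>E. f e i :: 'a::comm_monoid_add)"
  by (induction E rule: infinite_finite_induct) auto

text \<open>An injective linear map has a linear left inverse; here both are written as families of coefficients, because
the coefficients of the left inverse are later lifted from \<open>f3\<close> to the integers.\<close>

lemma left_inverse_of_trivial_kernel:
  fixes r :: "'e \<Rightarrow> nat \<Rightarrow> 'f::field"
  assumes fin: "finite E"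
    and ker: "\<And>\<phi>. (\<forall>e\<in>E. (\<Sum>j<n. r e j * \<phi> j) = 0) \<Longrightarrow> \<forall>j<n. \<phi> j = 0"
  obtains L where "\<And>i j. i < n \<Longrightarrow> j < n \<Longrightarrow> (\<Sum>e\<in>E. L i e * r e j) = (if i = j then 1 else 0)"
proof -
  let ?s1 = "\<lambda>(c::'f) (v::nat \<Rightarrow> 'f) j. c * v j"
  let ?s2 = "\<lambda>(c::'f) (v::'e \<Rightarrow> 'f) e. c * v e"
  interpret vector_space_pair ?s1 ?s2
    by unfold_locales (auto simp: fun_eq_iff algebra_simps)
  define f where "f = (\<lambda>\<phi> e. if e \<in> E then \<Sum>j<n. r e j * \<phi> j else 0)"
  define V where "V = {\<phi> :: nat \<Rightarrow> 'f. \<forall>j\<ge>n. \<phi> j = 0}"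
  have lin: "Vector_Spaces.linear ?s1 ?s2 f"
    by unfold_locales (auto simp: f_def fun_eq_iff algebra_simps sum.distrib sum_distrib_left)
  have sub: "vs1.subspace V" by (auto simp: vs1.subspace_def V_def)
  have "inj_on f V"
  proof (subst linear_inj_on_iff_eq_0[OF lin sub], intro ballI impI)
    fix \<phi> assume "\<phi> \<in> V" "f \<phi> = 0"
    then have "\<forall>e\<in>E. (\<Sum>j<n. r e j * \<phi> j) = 0" by (metis f_def zero_fun_apply)
    from ker[OF this] \<open>\<phi> \<in> V\<close> show "\<phi> = 0"
      by (auto simp: V_def fun_eq_iff) (meson not_le)
  qed
  from linear_exists_left_inverse_on[OF lin sub this] obtain g
    where lg: "Vector_Spaces.linear ?s2 ?s1 g" and g: "\<And>v. v \<in> V \<Longrightarrow> g (f v) = v" by blast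
  interpret G: Vector_Spaces.linear ?s2 ?s1 g by (rule lg)
  define \<delta> where "\<delta> = (\<lambda>(e::'e) e'. if e' = e then 1 else (0::'f))"
  have "(\<Sum>e\<in>E. g (\<delta> e) i * r e j) = (if i = j then 1 else 0)" if "i < n" "j < n" for i j
  proof -
    define d where "d = (\<lambda>k. if k = j then 1 else (0::'f))"
    have "f d = (\<Sum>e\<in>E. ?s2 (r e j) (\<delta> e))"
      using that fin by (auto simp: f_def d_def \<delta>_def fun_eq_iff sum_fun_eval if_distrib cong: if_cong)
    then have "g (f d) = (\<Sum>e\<in>E. ?s1 (r e j) (g (\<delta> e)))"
      by (simp add: G.sum G.scale)
    moreover have "g (f d) = d" using that by (intro g) (auto simp: V_def d_def)
    ultimately have "d i = (\<Sum>e\<in>E. r e j * g (\<delta> e) i)" by (simp add: sum_fun_eval)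
    then show ?thesis by (auto simp: d_def mult.commute)
  qed
  then show ?thesis by (rule that)
qed

section \<open>Triple systems with colourings of zero sum\<close>

definition num_triples :: "('a set \<Rightarrow> bool) \<Rightarrow> 'a set \<Rightarrow> nat" where
  "num_triples H Q = card {\<Delta>. \<Delta> \<subseteq> Q \<and> card \<Delta> = 3 \<and> H \<Delta>}"

lemma finite_triples: "finite Q \<Longrightarrow> finite {\<Delta>. \<Delta> \<subseteq> Q \<and> card \<Delta> = 3 \<and> H \<Delta>}"
  by (rule finite_subset[of _ "Pow Q"]) auto

lemma num_triples_tripartite:
  fixes \<phi> :: "'a \<Rightarrow> f3"
  assumes fin: "finite Q"
    and \<phi>: "\<And>\<Delta>. \<Delta> \<subseteq> Q \<Longrightarrow> card \<Delta> = 3 \<Longrightarrow> H \<Delta> \<Longrightarrow> (\<Sum>x\<in>\<Delta>. \<phi> x) = 0"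
  defines "cls \<equiv> \<lambda>i. {x \<in> Q. \<phi> x = i}"
  shows "num_triples H Q \<le> card (cls F0) * card (cls F1) * card (cls F2)
     + num_triples H (cls F0) + num_triples H (cls F1) + num_triples H (cls F2)"
proof -
  let ?N = "\<lambda>Q. {\<Delta>. \<Delta> \<subseteq> Q \<and> card \<Delta> = 3 \<and> H \<Delta>}"
  let ?X = "(\<lambda>(x, y, z). {x, y, z}) ` (cls F0 \<times> cls F1 \<times> cls F2)"
  have finp: "finite (cls i)" for i using fin by (simp add: cls_def)
  have "?N Q \<subseteq> ?X \<union> ?N (cls F0) \<union> ?N (cls F1) \<union> ?N (cls F2)"
  proof
    fix \<Delta> assume "\<Delta> \<in> ?N Q"
    then have \<Delta>: "\<Delta> \<subseteq> Q" "card \<Delta> = 3" "H \<Delta>" by auto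
    from \<Delta>(2) obtain x y z where xyz: "\<Delta> = {x, y, z}" "x \<noteq> y" "y \<noteq> z" "x \<noteq> z"
      by (auto simp: card_3_iff)
    with \<phi>[OF \<Delta>] have "\<phi> x + \<phi> y + \<phi> z = 0" by (simp add: add.assoc)
    from f3_sum_zero_cases[OF this] show "\<Delta> \<in> ?X \<union> ?N (cls F0) \<union> ?N (cls F1) \<union> ?N (cls F2)"
    proof
      assume "\<phi> x = \<phi> y \<and> \<phi> y = \<phi> z"
      then have "\<Delta> \<subseteq> cls (\<phi> x)" using \<Delta>(1) xyz by (auto simp: cls_def)
      then show ?thesis using \<Delta> by (cases "\<phi> x") auto
    next
      assume "{\<phi> x, \<phi> y, \<phi> z} = {F0, F1, F2}"
      then have "F0 \<in> \<phi> ` \<Delta>" "F1 \<in> \<phi> ` \<Delta>" "F2 \<in> \<phi> ` \<Delta>" using xyz by auto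
      then obtain u v w where uvw: "u \<in> \<Delta>" "v \<in> \<Delta>" "w \<in> \<Delta>" "\<phi> u = F0" "\<phi> v = F1" "\<phi> w = F2"
        by (metis imageE)
      then have "u \<noteq> v" "v \<noteq> w" "u \<noteq> w" by auto
      then have "card {u, v, w} = card \<Delta>" using \<Delta>(2) by simp
      moreover have "finite \<Delta>" using xyz by simp
      ultimately have "\<Delta> = {u, v, w}" using uvw card_subset_eq[of \<Delta> "{u, v, w}"] by auto
      then have "\<Delta> \<in> ?X" using uvw \<Delta>(1) by (auto simp: cls_def image_iff)
      then show ?thesis by blast
    qed
  qed
  then have "num_triples H Q \<le> card (?X \<union> ?N (cls F0) \<union> ?N (cls F1) \<union> ?N (cls F2))"
    unfolding num_triples_def using finp by (intro card_mono) (auto intro: finite_triples)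
  also have "\<dots> \<le> card ?X + card (?N (cls F0)) + card (?N (cls F1)) + card (?N (cls F2))"
    by (meson add_le_mono1 card_Un_le le_trans)
  also have "card ?X \<le> card (cls F0 \<times> cls F1 \<times> cls F2)"
    using finp by (intro card_image_le) auto
  finally show ?thesis by (simp add: num_triples_def card_cartesian_product mult.assoc)
qed

text \<open>Since \<open>(a + b + c)^3 - a^3 - b^3 - c^3 = 3 (a + b) (b + c) (c + a)\<close>, this is the bound
\<open>(a + b) (b + c) (c + a) \<ge> 8 a b c\<close>, and so the step on which the induction below turns.\<close>

lemma product_le_cube_of_sum_minus_cubes:
  fixes a b c :: real
  assumes "a \<ge> 0" "b \<ge> 0" "c \<ge> 0"
  shows "24 * (a * b * c) + a ^ 3 + b ^ 3 + c ^ 3 \<le> (a + b + c) ^ 3"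
proof -
  have "0 \<le> 3 * (a * (b - c)\<^sup>2 + b * (c - a)\<^sup>2 + c * (a - b)\<^sup>2)" using assms by simp
  then show ?thesis by (simp add: power2_eq_square power3_eq_cube algebra_simps)
qed

text \<open>If every subset has a nonconstant colouring whose sum over each selected triple vanishes, the triples form
an iterated tripartite system: they are transversal to the three colour classes or lie inside one of them, and the
classes are smaller sets of the same kind. The extremal case is the balanced iterated partition, of density one quarter.\<close>

lemma num_triples_le_cube:
  assumes fin: "finite Q"
    and col: "\<And>R. R \<subseteq> Q \<Longrightarrow> card R \<ge> 2 \<Longrightarrow>
      \<exists>\<phi> :: 'a \<Rightarrow> f3. \<not> \<phi> constant_on R \<and>
        (\<forall>\<Delta>\<subseteq>R. card \<Delta> = 3 \<longrightarrow> H \<Delta> \<longrightarrow> (\<Sum>x\<in>\<Delta>. \<phi> x) = 0)"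
  shows "24 * real (num_triples H Q) \<le> real (card Q) ^ 3"
  using assms
proof (induction "card Q" arbitrary: Q rule: less_induct)
  case less
  show ?case
  proof (cases "card Q \<ge> 2")
    case False
    have "{\<Delta>. \<Delta> \<subseteq> Q \<and> card \<Delta> = 3 \<and> H \<Delta>} = {}"
    proof (rule equals0I)
      fix \<Delta> assume "\<Delta> \<in> {\<Delta>. \<Delta> \<subseteq> Q \<and> card \<Delta> = 3 \<and> H \<Delta>}"
      then have "3 \<le> card Q" using card_mono[OF less.prems(1), of \<Delta>] by simp
      with False show False by simp
    qed
    then have "num_triples H Q = 0" unfolding num_triples_def by (simp only: card.empty)
    then show ?thesis by simp
  next
    case True
    from less.prems(2)[OF order_refl True] obtain \<phi> :: "'a \<Rightarrow> f3"
      where nc: "\<not> \<phi> constant_on Q"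
        and \<phi>: "\<And>\<Delta>. \<Delta> \<subseteq> Q \<Longrightarrow> card \<Delta> = 3 \<Longrightarrow> H \<Delta> \<Longrightarrow> (\<Sum>x\<in>\<Delta>. \<phi> x) = 0"
      by blast
    define cls where "cls = (\<lambda>i. {x \<in> Q. \<phi> x = i})"
    have fin: "finite Q" by fact
    have sub: "cls i \<subset> Q" for i
      using nc by (auto simp: cls_def constant_on_def)
    have IH: "24 * real (num_triples H (cls i)) \<le> real (card (cls i)) ^ 3" for i
      using psubset_card_mono[OF fin sub] sub[of i] fin less.prems(2)
      by (intro less.hyps) (auto intro: finite_subset simp: psubset_eq)
    have "Q = cls F0 \<union> cls F1 \<union> cls F2"
      by (auto simp: cls_def intro: f3.exhaust)
    moreover have "card (cls F0 \<union> cls F1 \<union> cls F2) = card (cls F0) + card (cls F1) + card (cls F2)"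
      using fin by (subst card_Un_disjoint; (subst card_Un_disjoint)?) (auto simp: cls_def)
    ultimately have Q: "real (card Q) = card (cls F0) + card (cls F1) + card (cls F2)"
      by simp
    have le: "num_triples H Q \<le> card (cls F0) * card (cls F1) * card (cls F2)
       + num_triples H (cls F0) + num_triples H (cls F1) + num_triples H (cls F2)"
      unfolding cls_def by (rule num_triples_tripartite[OF fin \<phi>])
    have "real (num_triples H Q) \<le> real (card (cls F0)) * card (cls F1) * card (cls F2)
       + num_triples H (cls F0) + num_triples H (cls F1) + num_triples H (cls F2)"
      using of_nat_mono[OF le, where 'a = real] by simp
    then show ?thesis
      using IH[of F0] IH[of F1] IH[of F2]
        product_le_cube_of_sum_minus_cubes[of "card (cls F0)" "card (cls F1)" "card (cls F2)"]
      unfolding Q by simp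
  qed
qed

text \<open>A bound on the density in all subsets of one size passes to larger sets one point at a time: deleting each of
\<open>n + 1\<close> points in turn counts every triple \<open>n - 2\<close> times.\<close>

lemma num_triples_averaging:
  assumes "k \<ge> 3" "finite P" "card P \<ge> k"
    and "\<And>Q. Q \<subseteq> P \<Longrightarrow> card Q = k \<Longrightarrow> real (num_triples H Q) \<le> c * real (k choose 3)"
  shows "real (num_triples H P) \<le> c * real (card P choose 3)"
proof -
  let ?N = "\<lambda>Q. {\<Delta>. \<Delta> \<subseteq> Q \<and> card \<Delta> = 3 \<and> H \<Delta>}"
  have "real (num_triples H R) \<le> c * real (m choose 3)"
    if "m \<ge> k" "card R = m" "R \<subseteq> P" for m R
    using that
  proof (induction m arbitrary: R rule: dec_induct)
    case base
    then show ?case using assms(4) by simp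
  next
    case (step n)
    have fin: "finite R" using step.prems \<open>finite P\<close> by (auto intro: finite_subset)
    have n: "card R = Suc n" "n \<ge> 3" using step \<open>k \<ge> 3\<close> by auto
    have "(\<Sum>v\<in>R. num_triples H (R - {v})) = (\<Sum>v\<in>R. \<Sum>\<Delta>\<in>?N R. if v \<notin> \<Delta> then 1 else 0)"
    proof (intro sum.cong refl)
      fix v
      have "?N (R - {v}) = {\<Delta> \<in> ?N R. v \<notin> \<Delta>}" by auto
      then show "num_triples H (R - {v}) = (\<Sum>\<Delta>\<in>?N R. if v \<notin> \<Delta> then 1 else 0)"
        using finite_triples[OF fin, of H] by (simp add: num_triples_def flip: sum.inter_filter)
    qed
    also have "\<dots> = (\<Sum>\<Delta>\<in>?N R. \<Sum>v\<in>R. if v \<notin> \<Delta> then 1 else 0)" by (rule sum.swap)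
    also have "\<dots> = (\<Sum>\<Delta>\<in>?N R. n - 2)"
    proof (intro sum.cong refl)
      fix \<Delta> assume "\<Delta> \<in> ?N R"
      then have "card (R - \<Delta>) = n - 2"
        using n fin by (subst card_Diff_subset) (auto intro: finite_subset)
      moreover have "R - \<Delta> = {v \<in> R. v \<notin> \<Delta>}" by auto
      ultimately show "(\<Sum>v\<in>R. if v \<notin> \<Delta> then 1 else 0) = n - 2"
        using fin by (simp flip: sum.inter_filter)
    qed
    also have "\<dots> = (n - 2) * num_triples H R" by (simp add: num_triples_def)
    finally have "real (n - 2) * num_triples H R = (\<Sum>v\<in>R. real (num_triples H (R - {v})))"
      by (metis of_nat_mult of_nat_sum)
    also have "\<dots> \<le> (\<Sum>v\<in>R. c * real (n choose 3))"
    proof (rule sum_mono)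
      fix v assume "v \<in> R"
      then have "card (R - {v}) = n" using n fin by simp
      then show "real (num_triples H (R - {v})) \<le> c * real (n choose 3)"
        using step.prems by (intro step.IH) auto
    qed
    also have "\<dots> = c * (real (Suc n) * real (n choose 3))" using n by simp
    also have "Suc n * (n choose 3) = (n - 2) * (Suc n choose 3)"
      using binomial_absorb_comp[of "Suc n" 3] by simp
    then have "real (Suc n) * real (n choose 3) = real (n - 2) * real (Suc n choose 3)"
      by (metis of_nat_mult)
    finally have "real (n - 2) * num_triples H R \<le> real (n - 2) * (c * real (Suc n choose 3))"
      by (simp add: mult_ac)
    moreover have "real (n - 2) > 0" using n by simp
    ultimately show ?case using mult_le_cancel_left_pos by blast
  qed
  from this[OF assms(3) refl order_refl] show ?thesis .
qed

section \<open>The linear relation between the vertices of a triangle\<close>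

definition to_complex :: "real ^ 2 \<Rightarrow> complex" where
  "to_complex v = Complex (vec_nth v 1) (vec_nth v 2)"

lemma inj_to_complex: "inj to_complex"
  by (auto simp: inj_def to_complex_def Finite_Cartesian_Product.vec_eq_iff forall_2)

lemma inner_real2: "inner (u :: real ^ 2) v = vec_nth u 1 * vec_nth v 1 + vec_nth u 2 * vec_nth v 2"
  by (simp add: inner_vec_def sum_2)

definition cross2 :: "real ^ 2 \<Rightarrow> real ^ 2 \<Rightarrow> real" where
  "cross2 u v = vec_nth u 1 * vec_nth v 2 - vec_nth u 2 * vec_nth v 1"

lemma cross2_squared: "(cross2 u v)\<^sup>2 = (norm u * norm v)\<^sup>2 - (inner u v)\<^sup>2"
  unfolding power_mult_distrib power2_norm_eq_inner
  by (simp add: inner_real2 cross2_def power2_eq_square algebra_simps)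

lemma cross2_nonzero:
  assumes "\<not> collinear {a, b, c}"
  shows "cross2 (b - a) (c - a) \<noteq> 0"
proof
  assume "cross2 (b - a) (c - a) = 0"
  then have "(inner (b - a) (c - a))\<^sup>2 = (norm (b - a) * norm (c - a))\<^sup>2"
    using cross2_squared[of "b - a" "c - a"] by simp
  then have "\<bar>inner (b - a) (c - a)\<bar> = norm (b - a) * norm (c - a)"
    by (metis abs_norm_cancel abs_mult real_sqrt_abs)
  then have "collinear {0, b - a, c - a}" by (simp add: norm_cauchy_schwarz_equal)
  then have "collinear {b, a, c}" by (subst collinear_3) simp
  with assms show False by (simp add: insert_commute)
qed

lemma angle_at_cos_sin:
  assumes "a \<noteq> b" "a \<noteq> c"
  shows "cos (angle_at a b c) = (inner (b - a) (c - a)) / (norm (b - a) * norm (c - a))"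
    and "sin (angle_at a b c) = \<bar>cross2 (b - a) (c - a)\<bar> / (norm (b - a) * norm (c - a))"
proof -
  let ?l = "norm (b - a) * norm (c - a)" and ?i = "inner (b - a) (c - a)"
  have l: "?l > 0" using assms by simp
  have "\<bar>?i\<bar> \<le> ?l" by (rule Cauchy_Schwarz_ineq2)
  with l have i: "-1 \<le> ?i / ?l" "?i / ?l \<le> 1" by (auto simp: field_simps abs_le_iff)
  show "cos (angle_at a b c) = ?i / ?l" using i by (simp add: angle_at_def)
  have "sin (angle_at a b c) = sqrt (1 - (?i / ?l)\<^sup>2)"
    using i by (simp add: angle_at_def sin_arccos)
  also have "1 - (?i / ?l)\<^sup>2 = (?l\<^sup>2 - ?i\<^sup>2) / ?l\<^sup>2"
    using assms by (auto simp: power_divide diff_divide_distrib)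
  also have "\<dots> = (\<bar>cross2 (b - a) (c - a)\<bar> / ?l)\<^sup>2"
    by (simp add: cross2_squared power_divide)
  also have "sqrt \<dots> = \<bar>cross2 (b - a) (c - a)\<bar> / ?l" using l by simp
  finally show "sin (angle_at a b c) = \<bar>cross2 (b - a) (c - a)\<bar> / ?l" .
qed

text \<open>The linear relation between the vertices of a triangle with angles \<open>x, y\<close> at its first two vertices. Dividing by
\<open>sin (x + y)\<close> and taking the first vertex as origin, it says that the third vertex is the second one multiplied by
\<open>sin y / sin (x + y)\<close> (law of sines) and rotated by \<open>\<plusminus>x\<close>; the sign \<open>\<sigma>\<close> is the orientation. The coefficients add up
to zero. This form has no denominators, hence it stays meaningful, and entire in \<open>x\<close> and \<open>y\<close>, for degenerate shapes.\<close>

lemma triangle_vertex_relation: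
  fixes a b c :: "real ^ 2"
  assumes "\<not> collinear {a, b, c}"
  defines "x \<equiv> complex_of_real (angle_at a b c)" and "y \<equiv> complex_of_real (angle_at b c a)"
  obtains \<sigma> :: complex where "\<sigma> = 1 \<or> \<sigma> = -1"
    "sin x * (cos y - \<sigma> * \<i> * sin y) * to_complex a + sin y * (cos x + \<sigma> * \<i> * sin x) * to_complex b
       - sin (x + y) * to_complex c = 0"
proof -
  define D where "D = cross2 (b - a) (c - a)"
  define s where "s = sgn D"
  define l m q where "l = norm (b - a)" and "m = norm (c - a)" and "q = norm (c - b)"
  define p r where "p = inner (b - a) (c - a)" and "r = inner (c - b) (a - b)"
  have "D \<noteq> 0" unfolding D_def using assms(1) by (rule cross2_nonzero)
  have ne: "a \<noteq> b" "a \<noteq> c" "b \<noteq> c"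
    using assms(1) by (auto simp: insert_commute)
  then have pos: "l > 0" "m > 0" "q > 0" by (auto simp: l_def m_def q_def)
  have D': "cross2 (c - b) (a - b) = D" by (simp add: D_def cross2_def algebra_simps)
  \<comment> \<open>The side shared by both angles is the sum of the projections of the other two sides onto it.\<close>
  have l2: "l * l = p + r"
    unfolding l_def p_def r_def
    unfolding power2_eq_square[symmetric] power2_norm_eq_inner by (simp add: inner_real2 algebra_simps)
  have cs: "cos (angle_at a b c) = p / (l * m)" "sin (angle_at a b c) = \<bar>D\<bar> / (l * m)"
     "cos (angle_at b c a) = r / (q * l)" "sin (angle_at b c a) = \<bar>D\<bar> / (q * l)"
    using angle_at_cos_sin[of a b c] angle_at_cos_sin[of b c a] ne
    unfolding D' unfolding D_def[symmetric] p_def[symmetric] r_def[symmetric] l_def m_def q_def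
    by (simp_all add: norm_minus_commute)
  have sD: "s * \<bar>D\<bar> = D" by (simp add: s_def sgn_mult_abs)
  define f where "f = \<bar>D\<bar> / (l * l * m * q)"
  have cx: "sin x = of_real (\<bar>D\<bar> / (l * m))" "cos x = of_real (p / (l * m))"
      "sin y = of_real (\<bar>D\<bar> / (q * l))" "cos y = of_real (r / (q * l))"
    unfolding x_def y_def cos_of_real sin_of_real cs by (rule refl)+
  have 1: "sin x * (cos y - of_real s * \<i> * sin y) = of_real f * (of_real r - \<i> * of_real D)"
  proof -
    have "sin x * (cos y - of_real s * \<i> * sin y)
        = of_real (\<bar>D\<bar> / (l * m)) * (of_real (r / (q * l)) - \<i> * of_real (s * \<bar>D\<bar> / (q * l)))"
      by (simp add: cx)
    also have "\<dots> = of_real f * (of_real r - \<i> * of_real D)"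
    proof -
      have "\<bar>D\<bar> / (l * m) * (r / (q * l)) = f * r" "\<bar>D\<bar> / (l * m) * (D / (q * l)) = f * D"
        by (simp_all add: f_def mult_ac)
      then show ?thesis unfolding sD
        by (simp only: right_diff_distrib mult.left_commute[of _ \<i>] flip: of_real_mult)
    qed
    finally show ?thesis .
  qed
  have 2: "sin y * (cos x + of_real s * \<i> * sin x) = of_real f * (of_real p + \<i> * of_real D)"
  proof -
    have "sin y * (cos x + of_real s * \<i> * sin x)
        = of_real (\<bar>D\<bar> / (q * l)) * (of_real (p / (l * m)) + \<i> * of_real (s * \<bar>D\<bar> / (l * m)))"
      by (simp add: cx)
    also have "\<dots> = of_real f * (of_real p + \<i> * of_real D)"
    proof -
      have "\<bar>D\<bar> / (q * l) * (p / (l * m)) = f * p" "\<bar>D\<bar> / (q * l) * (D / (l * m)) = f * D"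
        by (simp_all add: f_def mult_ac)
      then show ?thesis unfolding sD
        by (simp only: distrib_left mult.left_commute[of _ \<i>] flip: of_real_mult)
    qed
    finally show ?thesis .
  qed
  have "sin (x + y) = (sin x * (cos y - of_real s * \<i> * sin y)) + (sin y * (cos x + of_real s * \<i> * sin x))"
    by (simp add: sin_add algebra_simps)
  also have "\<dots> = of_real f * of_real (p + r)" unfolding 1 2 by (simp add: algebra_simps)
  finally have 3: "sin (x + y) = of_real f * of_real (p + r)" .
  have "(of_real r - \<i> * of_real D) * to_complex a + (of_real p + \<i> * of_real D) * to_complex b
      - of_real (p + r) * to_complex c = 0"
    unfolding p_def r_def D_def
    by (simp add: complex_eq_iff to_complex_def inner_real2 cross2_def algebra_simps)
  then have "of_real f * ((of_real r - \<i> * of_real D) * to_complex a + (of_real p + \<i> * of_real D) * to_complex b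
      - of_real (p + r) * to_complex c) = 0" by simp
  then have eq: "sin x * (cos y - of_real s * \<i> * sin y) * to_complex a + sin y * (cos x + of_real s * \<i> * sin x) * to_complex b
       - sin (x + y) * to_complex c = 0"
    unfolding 1 2 3 by (simp only: ring_distribs mult.assoc)
  have "s = 1 \<or> s = -1" using \<open>D \<noteq> 0\<close> by (auto simp: s_def sgn_if)
  then have "complex_of_real s = 1 \<or> complex_of_real s = -1" by auto
  from that[OF this eq] show ?thesis .
qed

section \<open>Determinants and entire functions\<close>

lemma det_mat_Leibniz:
  fixes q :: "nat \<Rightarrow> nat \<Rightarrow> complex"
  shows "Determinant.det (Matrix.mat n n (\<lambda>(i, j). q i j)) =
    (\<Sum>p\<in>{p. p permutes {0..<n}}. signof p * (\<Prod>i = 0..<n. q i (p i)))"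
  by (subst Determinant.det_def'[of _ n])
    (auto intro!: sum.cong prod.cong dest: permutes_in_image)

lemma tendsto_det:
  fixes f :: "'x \<Rightarrow> nat \<Rightarrow> nat \<Rightarrow> complex"
  assumes "\<And>i j. i < n \<Longrightarrow> j < n \<Longrightarrow> ((\<lambda>x. f x i j) \<longlongrightarrow> g i j) F"
  shows "((\<lambda>x. Determinant.det (Matrix.mat n n (\<lambda>(i, j). f x i j))) \<longlongrightarrow>
    Determinant.det (Matrix.mat n n (\<lambda>(i, j). g i j))) F"
proof -
  have "((\<lambda>x. \<Sum>p\<in>{p. p permutes {0..<n}}. signof p * (\<Prod>i = 0..<n. f x i (p i))) \<longlongrightarrow>
      (\<Sum>p\<in>{p. p permutes {0..<n}}. signof p * (\<Prod>i = 0..<n. g i (p i)))) F"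
    by (intro tendsto_sum tendsto_mult tendsto_prod tendsto_const assms)
      (auto dest: permutes_in_image)
  then show ?thesis by (simp only: det_mat_Leibniz)
qed

lemma holomorphic_on_det:
  fixes f :: "complex \<Rightarrow> nat \<Rightarrow> nat \<Rightarrow> complex"
  assumes "\<And>i j. i < n \<Longrightarrow> j < n \<Longrightarrow> (\<lambda>x. f x i j) holomorphic_on A"
  shows "(\<lambda>x. Determinant.det (Matrix.mat n n (\<lambda>(i, j). f x i j))) holomorphic_on A"
proof -
  have "(\<lambda>x. \<Sum>p\<in>{p. p permutes {0..<n}}. signof p * (\<Prod>i = 0..<n. f x i (p i))) holomorphic_on A"
    by (intro holomorphic_on_sum holomorphic_on_mult holomorphic_on_prod holomorphic_on_const assms)
      (auto dest: permutes_in_image)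
  then show ?thesis by (simp only: det_mat_Leibniz)
qed

lemma AE_entire_nonzero:
  fixes f :: "complex \<Rightarrow> complex"
  assumes "f holomorphic_on UNIV" "f z \<noteq> 0"
  shows "AE t in lborel. f (of_real t) \<noteq> 0"
proof -
  have "countable {w. f w = 0}"
  proof (cases "f constant_on UNIV")
    case True
    then have "{w. f w = 0} = {}" using assms(2) by (auto simp: constant_on_def)
    then show ?thesis by simp
  next
    case False
    from holomorphic_countable_zeros[OF assms(1) _ _ _ False] show ?thesis by (simp add: convex_connected)
  qed
  then have "countable {t. f (complex_of_real t) = 0}"
    using countable_image_inj_on[of complex_of_real "{t. f (of_real t) = 0}"]
      countable_subset[of "complex_of_real ` {t. f (of_real t) = 0}" "{w. f w = 0}"]
    by (auto simp: inj_on_def intro: countable_image_inj_on)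
  then have "{t. f (complex_of_real t) = 0} \<in> null_sets lborel"
    by (rule countable_imp_null_set_lborel)
  from AE_not_in[OF this] show ?thesis by simp
qed

text \<open>A function of two variables that is entire in each of them and not identically zero is nonzero at almost all
real points. Fubini reduces this to one variable: for almost every \<open>u\<close> the value at \<open>(u, v0)\<close> is nonzero, and for
each such \<open>u\<close> the function of \<open>v\<close> has only countably many zeros.\<close>

lemma AE_separately_entire_nonzero:
  fixes f :: "complex \<Rightarrow> complex \<Rightarrow> complex"
  assumes h1: "\<And>v. (\<lambda>u. f u v) holomorphic_on UNIV" and h2: "\<And>u. f u holomorphic_on UNIV"
    and cont: "continuous_on UNIV (\<lambda>(u, v). f (complex_of_real u) (complex_of_real v))"
    and nz: "f u0 v0 \<noteq> 0"
  shows "AE (u, v) in lborel. f (of_real u) (of_real v) \<noteq> 0"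
proof -
  have "AE u in lborel. AE v in lborel. f (of_real u) (of_real v) \<noteq> 0"
    using AE_entire_nonzero[OF h1 nz]
    by eventually_elim (rule AE_entire_nonzero[OF h2])
  moreover have "{p. (\<lambda>(u, v). f (of_real u) (of_real v)) p \<noteq> 0} \<in> sets (borel :: (real \<times> real) measure)"
    using cont by (intro borel_open open_Collect_neq continuous_on_const) auto
  then have "{p \<in> space (lborel \<Otimes>\<^sub>M lborel). (\<lambda>(u, v). f (of_real u) (of_real v)) p \<noteq> 0}
      \<in> sets (lborel \<Otimes>\<^sub>M lborel)"
    unfolding lborel_prod by simp
  ultimately have "AE p in (lborel \<Otimes>\<^sub>M lborel). (\<lambda>(u, v). f (of_real u) (of_real v)) p \<noteq> 0"
    by (intro lborel_pair.AE_pair_measure) (simp_all only: prod.case)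
  then show ?thesis unfolding lborel_prod by (simp add: case_prod_beta)
qed

section \<open>The determinant of a system of triangles\<close>

text \<open>The indices of the vertices with the first, second and third angle, in this order, and whether the
triangle is positively oriented.\<close>

type_synonym labelled_triple = "nat \<times> nat \<times> nat \<times> bool"

text \<open>The coefficient of vertex \<open>j\<close> in the linear relation that a triangle of the given shape imposes on its vertices.\<close>

fun relation_coeff :: "labelled_triple \<Rightarrow> complex \<times> complex \<Rightarrow> nat \<Rightarrow> complex" where
  "relation_coeff (a, b, c, s) (x, y) j =
     of_bool (j = a) * (sin x * (cos y - (if s then 1 else -1) * \<i> * sin y))
   + of_bool (j = b) * (sin y * (cos x + (if s then 1 else -1) * \<i> * sin x))
   - of_bool (j = c) * sin (x + y)"

text \<open>The relations of the triples in \<open>E\<close> among the points \<open>0, \<dots>, n\<close>, written in the coordinates that put point \<open>n\<close> at the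
origin, have a coefficient matrix with one row for each triple and \<open>n\<close> columns. Multiplying it from the left by the integer
matrix \<open>L\<close> gives a square matrix, and this is its determinant. The shape \<open>\<theta> e\<close> may depend on the triple, since
triangles that are only nearly similar have different angles.\<close>

definition shape_det ::
  "(nat \<Rightarrow> labelled_triple \<Rightarrow> int) \<Rightarrow> labelled_triple set \<Rightarrow> nat \<Rightarrow> (labelled_triple \<Rightarrow> complex \<times> complex) \<Rightarrow> complex"
where
  "shape_det L E n \<theta> = Determinant.det (Matrix.mat n n
     (\<lambda>(i, j). \<Sum>e\<in>E. of_int (L i e) * relation_coeff e (\<theta> e) j))"

text \<open>Adding a constant to a colouring keeps the sums over all triples zero, as \<open>3 = 0\<close> in \<open>f3\<close>; hence the
normalisation \<open>\<phi> n = 0\<close>, under which constant means zero.\<close>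

definition only_trivial_colouring :: "labelled_triple set \<Rightarrow> nat \<Rightarrow> bool" where
  "only_trivial_colouring E n \<longleftrightarrow>
     (\<forall>\<phi> :: nat \<Rightarrow> f3. (\<forall>(a, b, c, s)\<in>E. \<phi> a + \<phi> b + \<phi> c = 0) \<longrightarrow> \<phi> n = 0 \<longrightarrow> (\<forall>j<n. \<phi> j = 0))"

text \<open>Letting both angles tend to zero at the same rate flattens the triangle to a segment with its midpoint. The limit
no longer depends on the orientation, and modulo three it is the indicator function of the triple.\<close>

lemma relation_coeff_degenerate:
  "((\<lambda>\<eta>. relation_coeff (a, b, c, s) (\<eta>, \<eta>) j / \<eta>) \<longlongrightarrow>
     of_int (of_bool (j = a) + of_bool (j = b) - 2 * of_bool (j = c))) (at 0)"
proof -
  let ?\<sigma> = "if s then 1 else -1 :: complex"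
  have 1: "((\<lambda>\<eta>. sin \<eta> / \<eta> :: complex) \<longlongrightarrow> 1) (at 0)"
    using DERIV_sin[of "0 :: complex"] by (simp add: DERIV_def)
  have "((\<lambda>\<eta>. sin (\<eta> + \<eta>) :: complex) has_field_derivative 2) (at 0)"
    by (auto intro!: derivative_eq_intros)
  then have 2: "((\<lambda>\<eta>. sin (\<eta> + \<eta>) / \<eta> :: complex) \<longlongrightarrow> 2) (at 0)"
    by (simp add: DERIV_def)
  have t: "((\<lambda>\<eta>. cos \<eta> + z * sin \<eta>) \<longlongrightarrow> cos 0 + z * sin 0) (at 0)" for z :: complex
    by (intro tendsto_intros)
  have "((\<lambda>\<eta>. of_bool (j = a) * (sin \<eta> / \<eta> * (cos \<eta> + - (?\<sigma> * \<i>) * sin \<eta>))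
       + of_bool (j = b) * (sin \<eta> / \<eta> * (cos \<eta> + (?\<sigma> * \<i>) * sin \<eta>))
       - of_bool (j = c) * (sin (\<eta> + \<eta>) / \<eta>)) \<longlongrightarrow>
     of_bool (j = a) * (1 * (cos 0 + - (?\<sigma> * \<i>) * sin 0))
       + of_bool (j = b) * (1 * (cos 0 + (?\<sigma> * \<i>) * sin 0)) - of_bool (j = c) * 2) (at 0)"
    by (intro tendsto_add tendsto_diff tendsto_mult tendsto_const t 1 2)
  moreover have "of_bool (j = a) * (sin \<eta> / \<eta> * (cos \<eta> + - (?\<sigma> * \<i>) * sin \<eta>))
       + of_bool (j = b) * (sin \<eta> / \<eta> * (cos \<eta> + (?\<sigma> * \<i>) * sin \<eta>))
       - of_bool (j = c) * (sin (\<eta> + \<eta>) / \<eta>) = relation_coeff (a, b, c, s) (\<eta>, \<eta>) j / \<eta>" for \<eta>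
    by (simp only: relation_coeff.simps) (simp add: add_divide_distrib diff_divide_distrib)
  ultimately show ?thesis by (simp add: mult.commute)
qed

text \<open>If the incidence matrix of the triples has trivial kernel over \<open>f3\<close>, take \<open>L\<close> to be an integer lift of a left
inverse. At the degenerate shape the product of \<open>L\<close> with the rescaled coefficient matrix is an integer matrix that reduces to the
identity modulo three, so its determinant is not zero, and by continuity neither is that of some nearby shape.\<close>

lemma shape_det_nonzero_somewhere:
  assumes fin: "finite E" and triv: "only_trivial_colouring E n"
  obtains L \<eta> where "shape_det L E n (\<lambda>_. (\<eta>, \<eta>)) \<noteq> 0"
proof -
  define b :: "labelled_triple \<Rightarrow> nat \<Rightarrow> int" where
    "b = (\<lambda>(p, q, r, s) j. of_bool (j = p) + of_bool (j = q) - 2 * of_bool (j = r))"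
  have b3: "(of_int (b (p, q, r, s) j) :: f3) = of_bool (j = p) + of_bool (j = q) + of_bool (j = r)"
    for p q r s j
    using f3_minus_two by (simp add: b_def)
  have ker: "\<forall>j<n. \<phi> j = 0" if "\<forall>e\<in>E. (\<Sum>j<n. of_int (b e j) * \<phi> j) = 0" for \<phi> :: "nat \<Rightarrow> f3"
  proof -
    \<comment> \<open>A vector without entry for point \<open>n\<close> is a colouring with value zero there.\<close>
    define \<psi> where "\<psi> = (\<lambda>j. if j < n then \<phi> j else 0)"
    have *: "(\<Sum>j<n. of_bool (j = p) * \<phi> j) = \<psi> p" for p
      by (simp add: \<psi>_def of_bool_def if_distrib[of "\<lambda>x. x * _"] cong: if_cong)
    have "\<psi> p + \<psi> q + \<psi> r = 0" if "(p, q, r, s) \<in> E" for p q r s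
      using bspec[OF \<open>\<forall>e\<in>E. _\<close> that] unfolding b3
      by (simp add: ring_distribs sum.distrib *)
    then have "\<forall>(p, q, r, s)\<in>E. \<psi> p + \<psi> q + \<psi> r = 0" by blast
    moreover have "\<psi> n = 0" by (simp add: \<psi>_def)
    ultimately have "\<forall>j<n. \<psi> j = 0"
      using triv unfolding only_trivial_colouring_def by blast
    then show ?thesis by (simp add: \<psi>_def)
  qed
  from left_inverse_of_trivial_kernel[where r = "\<lambda>e j. of_int (b e j)", OF fin ker] obtain L' :: "nat \<Rightarrow> labelled_triple \<Rightarrow> f3"
    where L': "\<And>i j. i < n \<Longrightarrow> j < n \<Longrightarrow> (\<Sum>e\<in>E. L' i e * of_int (b e j)) = (if i = j then 1 else 0)"
    by blast
  define L where "L = (\<lambda>i e. SOME z. of_int z = L' i e)"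
  have L: "of_int (L i e) = L' i e" for i e
    unfolding L_def using f3_int_lift by (rule someI_ex)
  define B where "B = Matrix.mat n n (\<lambda>(i, j). \<Sum>e\<in>E. L i e * b e j)"
  have "Determinant.det B \<noteq> 0"
  proof
    interpret comm_ring_hom "of_int :: int \<Rightarrow> f3" by unfold_locales auto
    assume "Determinant.det B = 0"
    then have "Determinant.det (map_mat (of_int :: int \<Rightarrow> f3) B) = 0" by simp
    moreover have "map_mat (of_int :: int \<Rightarrow> f3) B = 1\<^sub>m n"
      by (rule eq_matI) (auto simp: B_def L L')
    ultimately show False by simp
  qed
  have "\<exists>\<eta>. shape_det L E n (\<lambda>_. (\<eta>, \<eta>)) \<noteq> 0"
  proof (rule ccontr)
    assume "\<not> ?thesis"
    then have z: "shape_det L E n (\<lambda>_. (\<eta>, \<eta>)) = 0" for \<eta> by blast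
    interpret comm_ring_hom complex_of_int by unfold_locales auto
    let ?f = "\<lambda>\<eta> i j. \<Sum>e\<in>E. of_int (L i e) * (relation_coeff e (\<eta>, \<eta>) j / \<eta>)"
    \<comment> \<open>All coefficients vanish to first order at \<open>\<eta> = 0\<close>; dividing by \<open>\<eta>\<close> keeps the determinant zero and leaves a nontrivial limit.\<close>
    have "((\<lambda>\<eta>. Determinant.det (Matrix.mat n n (\<lambda>(i, j). ?f \<eta> i j))) \<longlongrightarrow>
        Determinant.det (Matrix.mat n n (\<lambda>(i, j). \<Sum>e\<in>E. of_int (L i e) * of_int (b e j)))) (at 0)"
    proof (intro tendsto_det tendsto_sum tendsto_mult tendsto_const)
      fix j e
      show "((\<lambda>\<eta>. relation_coeff e (\<eta>, \<eta>) j / \<eta>) \<longlongrightarrow> of_int (b e j)) (at 0)"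
        by (cases e) (simp only: b_def prod.case relation_coeff_degenerate)
    qed
    moreover have "Determinant.det (Matrix.mat n n (\<lambda>(i, j). ?f \<eta> i j)) = 0" for \<eta>
    proof -
      have "Matrix.mat n n (\<lambda>(i, j). ?f \<eta> i j) = (1 / \<eta>) \<cdot>\<^sub>m
          Matrix.mat n n (\<lambda>(i, j). \<Sum>e\<in>E. of_int (L i e) * relation_coeff e (\<eta>, \<eta>) j)"
        by (rule eq_matI) (auto simp: sum_divide_distrib)
      then show ?thesis using z[of \<eta>] by (simp add: shape_det_def)
    qed
    ultimately have "Determinant.det (Matrix.mat n n
        (\<lambda>(i, j). \<Sum>e\<in>E. complex_of_int (L i e) * of_int (b e j))) = 0"
      by (simp add: tendsto_const_iff)
    moreover have "Matrix.mat n n (\<lambda>(i, j). \<Sum>e\<in>E. complex_of_int (L i e) * of_int (b e j))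
        = map_mat of_int B"
      by (rule eq_matI) (auto simp: B_def)
    ultimately show False using \<open>Determinant.det B \<noteq> 0\<close> by simp
  qed
  then show ?thesis using that by blast
qed

text \<open>In the coordinates of the chart the two angles are affine functions, so the determinant is entire in each coordinate.\<close>

lemma AE_shape_det_nonzero:
  assumes "finite E" and "only_trivial_colouring E n"
  shows "\<exists>L. AE T in shape_measure. case T of (\<alpha>, \<beta>, \<gamma>) \<Rightarrow>
    shape_det L E n (\<lambda>_. (of_real \<alpha>, of_real \<beta>)) \<noteq> 0"
proof -
  from shape_det_nonzero_somewhere[OF assms] obtain L \<eta>
    where nz: "shape_det L E n (\<lambda>_. (\<eta>, \<eta>)) \<noteq> 0" by blast
  let ?x = "\<lambda>u v :: complex. of_real (pi / 3) + u / of_real (sqrt 2) + v / of_real (sqrt 6)"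
  let ?y = "\<lambda>u v :: complex. of_real (pi / 3) - u / of_real (sqrt 2) + v / of_real (sqrt 6)"
  let ?f = "\<lambda>u v. shape_det L E n (\<lambda>_. (?x u v, ?y u v))"
  have "AE (u, v) in lborel. ?f (of_real u) (of_real v) \<noteq> 0"
  proof (rule AE_separately_entire_nonzero)
    show "(\<lambda>u. ?f u v) holomorphic_on UNIV" for v
      unfolding shape_det_def
    proof (intro holomorphic_on_det holomorphic_on_sum holomorphic_on_mult holomorphic_on_const)
      fix e j show "(\<lambda>u. relation_coeff e (?x u v, ?y u v) j) holomorphic_on UNIV"
        by (cases e) (auto simp only: relation_coeff.simps intro!: holomorphic_intros)
    qed
    show "?f u holomorphic_on UNIV" for u
      unfolding shape_det_def
    proof (intro holomorphic_on_det holomorphic_on_sum holomorphic_on_mult holomorphic_on_const)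
      fix e j show "(\<lambda>v. relation_coeff e (?x u v, ?y u v) j) holomorphic_on UNIV"
        by (cases e) (auto simp only: relation_coeff.simps intro!: holomorphic_intros)
    qed
    have "continuous_on UNIV (\<lambda>p. ?f (of_real (fst p)) (of_real (snd p)))"
      unfolding continuous_on_def shape_det_def
    proof (intro ballI tendsto_det tendsto_sum tendsto_mult tendsto_const)
      fix e j and p :: "real \<times> real"
      have "continuous_on UNIV (\<lambda>p. relation_coeff e (?x (of_real (fst p)) (of_real (snd p)),
          ?y (of_real (fst p)) (of_real (snd p))) j)"
        by (cases e, simp only: relation_coeff.simps, intro continuous_intros) simp_all
      then show "((\<lambda>p. relation_coeff e (?x (of_real (fst p)) (of_real (snd p)),
          ?y (of_real (fst p)) (of_real (snd p))) j) \<longlongrightarrow>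
          relation_coeff e (?x (of_real (fst p)) (of_real (snd p)),
          ?y (of_real (fst p)) (of_real (snd p))) j) (at p within UNIV)"
        unfolding continuous_on_def by (rule bspec) simp
    qed
    then show "continuous_on UNIV (\<lambda>(u, v). ?f (of_real u) (of_real v))"
      by (simp only: case_prod_unfold)
    \<comment> \<open>The shapes with two equal angles form the axis \<open>u = 0\<close> of the chart; this point of it has both angles equal to \<open>\<eta>\<close>.\<close>
    have "?x 0 ((\<eta> - of_real (pi / 3)) * of_real (sqrt 6)) = \<eta>"
      "?y 0 ((\<eta> - of_real (pi / 3)) * of_real (sqrt 6)) = \<eta>"
      by simp_all
    then show "?f 0 ((\<eta> - of_real (pi / 3)) * of_real (sqrt 6)) \<noteq> 0"
      using nz by (simp only: simp_thms)
  qed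
  then have "AE p in lebesgue. case shape_chart p of (\<alpha>, \<beta>, \<gamma>) \<Rightarrow>
      shape_det L E n (\<lambda>_. (of_real \<alpha>, of_real \<beta>)) \<noteq> 0"
    by (intro AE_completion) (simp add: shape_chart_def case_prod_unfold)
  then show ?thesis
    unfolding shape_measure_def
    by (intro exI[of _ L]) (simp add: AE_embed_measure[OF inj_shape_chart])
qed

lemma shape_det_nonzero_nearby:
  assumes nz: "shape_det L E n (\<lambda>_. (of_real \<alpha>, of_real \<beta>)) \<noteq> 0"
  shows "\<forall>\<^sub>F \<epsilon> in at_right 0. \<forall>x y. (\<forall>e\<in>E. \<bar>\<alpha> - x e\<bar> < \<epsilon> \<and> \<bar>\<beta> - y e\<bar> < \<epsilon>) \<longrightarrow>
    shape_det L E n (\<lambda>e. (of_real (x e), of_real (y e))) \<noteq> 0"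
proof -
  let ?P = "\<lambda>\<epsilon> x y. \<forall>e\<in>E. \<bar>\<alpha> - x e\<bar> < \<epsilon> \<and> \<bar>\<beta> - y e\<bar> < \<epsilon>"
  have "\<exists>\<delta>>0. \<forall>x y. ?P \<delta> x y \<longrightarrow> shape_det L E n (\<lambda>e. (of_real (x e), of_real (y e))) \<noteq> 0"
  proof (rule ccontr)
    assume neg: "\<not> ?thesis"
    define Q where "Q = (\<lambda>m x y. ?P (inverse (real (Suc m))) x y \<and>
      shape_det L E n (\<lambda>e. (of_real (x e), of_real (y e))) = 0)"
    have "\<exists>x y. Q m x y" for m
    proof -
      have "inverse (real (Suc m)) > 0" by simp
      with neg show ?thesis unfolding Q_def by blast
    qed
    then obtain x y where Q: "\<And>m. Q m (x m) (y m)" by metis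
    then have xy: "?P (inverse (real (Suc m))) (x m) (y m)"
      and z: "shape_det L E n (\<lambda>e. (of_real (x m e), of_real (y m e))) = 0" for m
      unfolding Q_def by blast+
    have lim: "(\<lambda>m. x m e) \<longlonglongrightarrow> \<alpha>" "(\<lambda>m. y m e) \<longlonglongrightarrow> \<beta>" if "e \<in> E" for e
    proof -
      have "\<bar>x m e - \<alpha>\<bar> < inverse (real (Suc m))" "\<bar>y m e - \<beta>\<bar> < inverse (real (Suc m))" for m
        using xy[of m] that by (auto simp: abs_minus_commute)
      then have "(\<lambda>m. x m e - \<alpha>) \<longlonglongrightarrow> 0" "(\<lambda>m. y m e - \<beta>) \<longlonglongrightarrow> 0"
        by (auto intro!: Lim_null_comparison[OF always_eventually LIMSEQ_inverse_real_of_nat]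
          simp del: of_nat_Suc intro: less_imp_le)
      then show "(\<lambda>m. x m e) \<longlonglongrightarrow> \<alpha>" "(\<lambda>m. y m e) \<longlonglongrightarrow> \<beta>"
        by (simp_all only: LIM_zero_iff)
    qed
    have "(\<lambda>m. shape_det L E n (\<lambda>e. (of_real (x m e), of_real (y m e))))
        \<longlonglongrightarrow> shape_det L E n (\<lambda>_. (of_real \<alpha>, of_real \<beta>))"
      unfolding shape_det_def
    proof (intro tendsto_det tendsto_sum tendsto_mult tendsto_const)
      fix e j assume "e \<in> E"
      note [tendsto_intros] = lim[OF this]
      show "(\<lambda>m. relation_coeff e (of_real (x m e), of_real (y m e)) j) \<longlonglongrightarrow>
          relation_coeff e (of_real \<alpha>, of_real \<beta>) j"
        using lim[OF \<open>e \<in> E\<close>]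
        by (cases e) (simp only: relation_coeff.simps, intro tendsto_intros)
    qed
    then show False using z nz by (simp add: LIMSEQ_const_iff)
  qed
  then obtain \<delta> where "\<delta> > 0"
    and \<delta>: "\<And>x y. ?P \<delta> x y \<Longrightarrow> shape_det L E n (\<lambda>e. (of_real (x e), of_real (y e))) \<noteq> 0" by blast
  show ?thesis
    unfolding eventually_at_right_field
  proof (intro exI[of _ \<delta>] conjI allI impI)
    fix \<epsilon> x y assume "\<epsilon> < \<delta>" "?P \<epsilon> x y"
    then have "?P \<delta> x y" by (meson less_trans)
    then show "shape_det L E n (\<lambda>e. (of_real (x e), of_real (y e))) \<noteq> 0" by (rule \<delta>)
  qed (rule \<open>\<delta> > 0\<close>)
qed

text \<open>If the determinant does not vanish, all points coincide: the positions relative to point \<open>n\<close> form a vector in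
the kernel of the coefficient matrix.\<close>

lemma shape_det_nonzero_rigid:
  fixes p :: "nat \<Rightarrow> complex"
  assumes nz: "shape_det L E n \<theta> \<noteq> 0"
    and E: "\<And>a b c s. (a, b, c, s) \<in> E \<Longrightarrow> a \<le> n \<and> b \<le> n \<and> c \<le> n"
    and rel: "\<And>e. e \<in> E \<Longrightarrow> (\<Sum>j\<le>n. relation_coeff e (\<theta> e) j * p j) = 0"
    and "j < n"
  shows "p j = p n"
proof -
  let ?q = "\<lambda>j. p j - p n"
  let ?M = "Matrix.mat n n (\<lambda>(i, j). \<Sum>e\<in>E. of_int (L i e) * relation_coeff e (\<theta> e) j)"
  have row: "(\<Sum>j<n. relation_coeff e (\<theta> e) j * ?q j) = 0" if "e \<in> E" for e
  proof -
    obtain a b c s where e: "e = (a, b, c, s)" by (cases e)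
    obtain x y where \<theta>: "\<theta> e = (x, y)" by (cases "\<theta> e")
    have abc: "a \<le> n" "b \<le> n" "c \<le> n" using E that e by auto
    have *: "(\<Sum>j\<le>n. of_bool (j = a) * z) = z" if "a \<le> n" for a and z :: complex
      using that by (simp add: of_bool_def if_distrib[of "\<lambda>x. x * _"] cong: if_cong)
    have "(\<Sum>j\<le>n. relation_coeff e (\<theta> e) j) = 0"
      using abc unfolding e \<theta>[unfolded e]
      by (simp only: relation_coeff.simps sum.distrib sum_subtractf *) (simp add: sin_add algebra_simps)
    then have "(\<Sum>j\<le>n. relation_coeff e (\<theta> e) j * ?q j) = 0"
      using rel[OF that] by (simp add: right_diff_distrib sum_subtractf flip: sum_distrib_right)
    then show ?thesis by (simp flip: lessThan_Suc_atMost)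
  qed
  have "?M *\<^sub>v Matrix.vec n ?q = 0\<^sub>v n"
  proof (rule eq_vecI)
    fix i assume "i < dim_vec (0\<^sub>v n :: complex Matrix.vec)"
    then have "vec_index (?M *\<^sub>v Matrix.vec n ?q) i =
        (\<Sum>j<n. (\<Sum>e\<in>E. of_int (L i e) * relation_coeff e (\<theta> e) j) * ?q j)"
      by (simp add: scalar_prod_def lessThan_atLeast0)
    also have "\<dots> = (\<Sum>e\<in>E. of_int (L i e) * (\<Sum>j<n. relation_coeff e (\<theta> e) j * ?q j))"
      unfolding sum_distrib_right sum_distrib_left by (subst sum.swap) (simp only: mult.assoc)
    also have "\<dots> = 0" using row by simp
    finally show "vec_index (?M *\<^sub>v Matrix.vec n ?q) i = vec_index (0\<^sub>v n)  i"
      using \<open>i < dim_vec (0\<^sub>v n :: complex Matrix.vec)\<close> by simp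
  qed simp
  then have "Matrix.vec n ?q = 0\<^sub>v n"
    using det_0_iff_vec_prod_zero[of ?M n] nz unfolding shape_det_def
    by (meson mat_carrier vec_carrier)
  then have "vec_index (Matrix.vec n ?q) j = vec_index (0\<^sub>v n)  j" by simp
  then show ?thesis using \<open>j < n\<close> by simp
qed

section \<open>Generic shapes\<close>

text \<open>There are only countably many systems of triples, so that the exceptional shapes of all of them together
still form a null set.\<close>

definition generic_shape :: "real \<Rightarrow> real \<Rightarrow> bool" where
  "generic_shape \<alpha> \<beta> \<longleftrightarrow> (\<forall>n E. finite E \<longrightarrow> only_trivial_colouring E n \<longrightarrow>
     (\<exists>L. shape_det L E n (\<lambda>_. (of_real \<alpha>, of_real \<beta>)) \<noteq> 0))"

lemma AE_generic_shape: "AE T in shape_measure. case T of (\<alpha>, \<beta>, \<gamma>) \<Rightarrow> generic_shape \<alpha> \<beta>"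
proof -
  let ?I = "{(n, E). finite E \<and> only_trivial_colouring E n}"
  have "countable (UNIV \<times> Collect finite :: (nat \<times> labelled_triple set) set)"
    by (intro countable_SIGMA countable_Collect_finite) auto
  then have "countable ?I" by (rule countable_subset[rotated]) auto
  moreover have "AE T in shape_measure. case T of (\<alpha>, \<beta>, \<gamma>) \<Rightarrow>
      \<exists>L. shape_det L (snd i) (fst i) (\<lambda>_. (of_real \<alpha>, of_real \<beta>)) \<noteq> 0" if "i \<in> ?I" for i
  proof -
    from that AE_shape_det_nonzero[of "snd i" "fst i"] obtain L
      where "AE T in shape_measure. case T of (\<alpha>, \<beta>, \<gamma>) \<Rightarrow>
        shape_det L (snd i) (fst i) (\<lambda>_. (of_real \<alpha>, of_real \<beta>)) \<noteq> 0" by auto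
    then show ?thesis by eventually_elim auto
  qed
  ultimately have "AE T in shape_measure. \<forall>i\<in>?I. case T of (\<alpha>, \<beta>, \<gamma>) \<Rightarrow>
      \<exists>L. shape_det L (snd i) (fst i) (\<lambda>_. (of_real \<alpha>, of_real \<beta>)) \<noteq> 0"
    by (intro iffD2[OF AE_ball_countable] ballI)
  then show ?thesis
  proof eventually_elim
    case (elim T)
    then show ?case by (cases T) (auto simp: generic_shape_def)
  qed
qed

text \<open>The heart of the argument. On at most \<open>k\<close> points there are finitely many systems of labelled triples, and for small
\<open>\<epsilon>\<close> every system without a nonconstant colouring has nonvanishing determinants at all shapes within \<open>\<epsilon>\<close> of the given one.
Such a system would force the points to coincide, hence the system formed by the \<open>\<epsilon>\<close>-similar triangles does have a nonconstant colouring.\<close>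

lemma generic_shape_colouring:
  assumes gen: "generic_shape \<alpha> \<beta>"
  shows "\<forall>\<^sub>F \<epsilon> in at_right 0. \<forall>Q. finite Q \<longrightarrow> 2 \<le> card Q \<longrightarrow> card Q \<le> k \<longrightarrow>
    (\<exists>\<phi> :: real ^ 2 \<Rightarrow> f3. \<not> \<phi> constant_on Q \<and>
      (\<forall>\<Delta>\<subseteq>Q. card \<Delta> = 3 \<longrightarrow> eps_similar \<Delta> (\<alpha>, \<beta>, \<gamma>) \<epsilon> \<longrightarrow> (\<Sum>x\<in>\<Delta>. \<phi> x) = 0))"
proof -
  define U :: "nat \<Rightarrow> labelled_triple set" where "U = (\<lambda>n. {..n} \<times> {..n} \<times> {..n} \<times> UNIV)"
  define near where "near = (\<lambda>E n \<epsilon>. \<exists>L. \<forall>x y. (\<forall>e\<in>E. \<bar>\<alpha> - x e\<bar> < \<epsilon> \<and> \<bar>\<beta> - y e\<bar> < \<epsilon>) \<longrightarrow>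
    shape_det L E n (\<lambda>e. (of_real (x e), of_real (y e))) \<noteq> 0)"
  have "\<forall>\<^sub>F \<epsilon> in at_right 0. near E n \<epsilon>" if "finite E" "only_trivial_colouring E n" for E n
  proof -
    from gen that obtain L where "shape_det L E n (\<lambda>_. (of_real \<alpha>, of_real \<beta>)) \<noteq> 0"
      unfolding generic_shape_def by blast
    from shape_det_nonzero_nearby[OF this] show ?thesis
      unfolding near_def by (rule eventually_mono) blast
  qed
  moreover have finU: "finite E" if "E \<subseteq> U n" for E n
    using that by (rule finite_subset) (simp add: U_def)
  ultimately have "\<forall>\<^sub>F \<epsilon> in at_right 0. \<forall>n\<in>{..<k}. \<forall>E\<in>{E. E \<subseteq> U n \<and> only_trivial_colouring E n}. near E n \<epsilon>"
  proof (intro eventually_ball_finite ballI)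
    show "finite {E. E \<subseteq> U n \<and> only_trivial_colouring E n}" for n
      by (rule finite_subset[of _ "Pow (U n)"]) (auto simp: U_def)
  qed auto
  then show ?thesis
  proof (rule eventually_mono, intro allI impI)
    fix \<epsilon> and Q :: "(real ^ 2) set"
    assume near: "\<forall>n\<in>{..<k}. \<forall>E\<in>{E. E \<subseteq> U n \<and> only_trivial_colouring E n}. near E n \<epsilon>"
    assume Q: "finite Q" "2 \<le> card Q" "card Q \<le> k"
    define n where "n = card Q - 1"
    have n: "card Q = Suc n" "n \<ge> 1" "n < k" using Q by (auto simp: n_def)
    from ex_bij_betw_nat_finite[OF Q(1)] obtain f where "bij_betw f {..n} Q"
      by (auto simp: n atLeast0LessThan lessThan_Suc_atMost)
    then have inj: "inj_on f {..n}" and img: "f ` {..n} = Q" by (auto simp: bij_betw_def)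
    define \<theta> where "\<theta> = (\<lambda>(a, b, c, s :: bool).
      (angle_at (f a) (f b) (f c), angle_at (f b) (f c) (f a)))"
    define E where "E = {e \<in> U n. \<bar>\<alpha> - fst (\<theta> e)\<bar> < \<epsilon> \<and> \<bar>\<beta> - snd (\<theta> e)\<bar> < \<epsilon> \<and>
      (\<Sum>j\<le>n. relation_coeff e (of_real (fst (\<theta> e)), of_real (snd (\<theta> e))) j * to_complex (f j)) = 0}"
    have "\<not> only_trivial_colouring E n"
    proof
      assume "only_trivial_colouring E n"
      moreover have "E \<subseteq> U n" by (auto simp: E_def)
      ultimately have "near E n \<epsilon>" using near n by blast
      then obtain L where "\<And>x y. (\<forall>e\<in>E. \<bar>\<alpha> - x e\<bar> < \<epsilon> \<and> \<bar>\<beta> - y e\<bar> < \<epsilon>) \<Longrightarrow>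
          shape_det L E n (\<lambda>e. (of_real (x e), of_real (y e))) \<noteq> 0"
        unfolding near_def by blast
      then have nz: "shape_det L E n (\<lambda>e. (of_real (fst (\<theta> e)), of_real (snd (\<theta> e)))) \<noteq> 0"
        by (auto simp: E_def)
      have "to_complex (f 0) = to_complex (f n)"
        using n by (intro shape_det_nonzero_rigid[OF nz, of "\<lambda>j. to_complex (f j)"]) (auto simp: E_def U_def)
      then have "f 0 = f n" using inj_to_complex by (auto dest: injD)
      with inj n show False by (auto dest: inj_onD)
    qed
    then obtain \<phi> :: "nat \<Rightarrow> f3" and j where \<phi>: "\<And>a b c s. (a, b, c, s) \<in> E \<Longrightarrow> \<phi> a + \<phi> b + \<phi> c = 0"
      and j: "\<phi> n = 0" "j < n" "\<phi> j \<noteq> 0"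
      unfolding only_trivial_colouring_def by blast
    define \<psi> where "\<psi> = \<phi> \<circ> inv_into {..n} f"
    have \<psi>: "\<psi> (f i) = \<phi> i" if "i \<le> n" for i
      using that inj by (simp add: \<psi>_def)
    show "\<exists>\<psi> :: real ^ 2 \<Rightarrow> f3. \<not> \<psi> constant_on Q \<and>
      (\<forall>\<Delta>\<subseteq>Q. card \<Delta> = 3 \<longrightarrow> eps_similar \<Delta> (\<alpha>, \<beta>, \<gamma>) \<epsilon> \<longrightarrow> (\<Sum>x\<in>\<Delta>. \<psi> x) = 0)"
    proof (intro exI[of _ \<psi>] conjI allI impI)
      have "f n \<in> Q" "f j \<in> Q" using img j by auto
      moreover have "\<psi> (f n) \<noteq> \<psi> (f j)" using j by (simp add: \<psi>)
      ultimately show "\<not> \<psi> constant_on Q" unfolding constant_on_def by metis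
    next
      fix \<Delta> assume "\<Delta> \<subseteq> Q" "card \<Delta> = 3" "eps_similar \<Delta> (\<alpha>, \<beta>, \<gamma>) \<epsilon>"
      then obtain p q r where pqr: "\<Delta> = {p, q, r}" "\<not> collinear {p, q, r}"
        "\<bar>\<alpha> - angle_at p q r\<bar> < \<epsilon>" "\<bar>\<beta> - angle_at q r p\<bar> < \<epsilon>"
        by (auto simp: eps_similar_def)
      with \<open>\<Delta> \<subseteq> Q\<close> obtain a b c where abc: "a \<le> n" "b \<le> n" "c \<le> n" "p = f a" "q = f b" "r = f c"
        unfolding img[symmetric] by auto
      obtain \<sigma> :: complex where "\<sigma> = 1 \<or> \<sigma> = -1"
        and rel: "sin (of_real (angle_at p q r)) * (cos (of_real (angle_at q r p)) - \<sigma> * \<i> * sin (of_real (angle_at q r p))) * to_complex p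
          + sin (of_real (angle_at q r p)) * (cos (of_real (angle_at p q r)) + \<sigma> * \<i> * sin (of_real (angle_at p q r))) * to_complex q
          - sin (of_real (angle_at p q r) + of_real (angle_at q r p)) * to_complex r = 0"
        using triangle_vertex_relation[OF pqr(2)] by blast
      then have \<sigma>: "\<sigma> = (if \<sigma> = 1 then 1 else -1)" by auto
      have pick: "(\<Sum>j\<le>n. of_bool (j = i) * z * w j) = z * w i" if "i \<le> n" for i z and w :: "nat \<Rightarrow> complex"
        using that by (simp add: of_bool_def if_distrib[of "\<lambda>x. x * _"] cong: if_cong)
      have "(a, b, c, \<sigma> = 1) \<in> E"
        using abc pqr rel \<sigma>
        by (simp add: E_def U_def \<theta>_def distrib_right left_diff_distrib sum.distrib sum_subtractf pick
          del: sum_of_bool_mult_eq sum_mult_of_bool_eq)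
      then have "\<phi> a + \<phi> b + \<phi> c = 0" by (rule \<phi>)
      moreover have "p \<noteq> q" "q \<noteq> r" "p \<noteq> r"
        using \<open>card \<Delta> = 3\<close> pqr(1) by (auto simp: card_insert_if split: if_splits)
      ultimately show "(\<Sum>x\<in>\<Delta>. \<psi> x) = 0"
        using abc by (simp add: pqr(1) \<psi> add.assoc)
    qed
  qed
qed

lemma choose_1000_3: "real (1000 choose 3) = 166167000"
proof -
  have "3 * (1000 choose 3) = 1000 * (999 choose 2)"
    using binomial_absorption[of 2 1000] by (simp add: numeral_3_eq_3 numeral_2_eq_2)
  then have "(1000 choose 3) = (166167000 :: nat)" by (simp add: choose_two)
  then show ?thesis by simp
qed

theorem theorem2p1:
  "AE T in shape_measure. T \<in> triangle_shapes \<longrightarrow>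
     (\<exists>\<epsilon>::real. \<epsilon> > 0 \<and> (case T of (\<alpha>, \<beta>, \<gamma>) \<Rightarrow> \<epsilon> < \<alpha> \<and> \<epsilon> < \<beta> \<and> \<epsilon> < \<gamma>) \<and>
        (\<exists>r :: nat \<Rightarrow> real. r \<in> o(\<lambda>_. 1) \<and>
           (\<forall>\<^sub>F n in sequentially. real (h n T \<epsilon>) \<le> 0.25108 * real (n choose 3) * (1 + r n))))"
  using AE_generic_shape
proof eventually_elim
  case (elim T)
  show ?case
  proof
    assume "T \<in> triangle_shapes"
    obtain \<alpha> \<beta> \<gamma> where T: "T = (\<alpha>, \<beta>, \<gamma>)" by (cases T)
    have gen: "generic_shape \<alpha> \<beta>" using elim T by simp
    have pos: "\<alpha> > 0" "\<beta> > 0" "\<gamma> > 0"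
      using \<open>T \<in> triangle_shapes\<close> by (auto simp: triangle_shapes_def T)
    \<comment> \<open>With \<open>k\<close> points the cubic bound is \<open>k\<^sup>2 / (4 (k - 1) (k - 2))\<close> times the number of triples, and this factor is below \<open>0.25108\<close> for \<open>k = 1000\<close>.\<close>
    let ?good = "\<lambda>\<epsilon>. \<forall>Q. finite Q \<longrightarrow> 2 \<le> card Q \<longrightarrow> card Q \<le> 1000 \<longrightarrow>
      (\<exists>\<phi> :: real ^ 2 \<Rightarrow> f3. \<not> \<phi> constant_on Q \<and>
        (\<forall>\<Delta>\<subseteq>Q. card \<Delta> = 3 \<longrightarrow> eps_similar \<Delta> T \<epsilon> \<longrightarrow> (\<Sum>x\<in>\<Delta>. \<phi> x) = 0))"
    have small: "\<forall>\<^sub>F \<epsilon> in at_right (0::real). 0 < \<epsilon> \<and> \<epsilon> < z" if "z > 0" for z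
      using that by (auto simp: eventually_at_right_field)
    have "\<forall>\<^sub>F \<epsilon> in at_right 0. ?good \<epsilon>"
      unfolding T by (rule generic_shape_colouring[OF gen])
    with small[OF pos(1)] small[OF pos(2)] small[OF pos(3)]
    have "\<forall>\<^sub>F \<epsilon> in at_right 0. \<epsilon> > 0 \<and> \<epsilon> < \<alpha> \<and> \<epsilon> < \<beta> \<and> \<epsilon> < \<gamma> \<and> ?good \<epsilon>"
      by eventually_elim (intro conjI; (elim conjE)?; assumption)
    from eventually_happens'[OF trivial_limit_at_right_real this] obtain \<epsilon>
      where \<epsilon>: "\<epsilon> > 0" "\<epsilon> < \<alpha>" "\<epsilon> < \<beta>" "\<epsilon> < \<gamma>" and good: "?good \<epsilon>"
      by (elim exE conjE) (rule that)
    let ?H = "\<lambda>\<Delta>. eps_similar \<Delta> T \<epsilon>"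
    have "real (h n T \<epsilon>) \<le> 0.25108 * real (n choose 3)" if "n \<ge> 1000" for n
    proof -
      obtain P where P: "finite P" "card P = n" "num_similar P T \<epsilon> = h n T \<epsilon>"
        using h_attained by blast
      have "real (num_triples ?H P) \<le> 0.25108 * real (card P choose 3)"
      proof (rule num_triples_averaging[where k = 1000])
        fix Q assume Q: "Q \<subseteq> P" "card Q = 1000"
        have fin: "finite Q" using Q P(1) by (auto intro: finite_subset)
        have "24 * real (num_triples ?H Q) \<le> real (card Q) ^ 3"
        proof (rule num_triples_le_cube[OF fin])
          fix R assume R: "R \<subseteq> Q" "card R \<ge> 2"
          have "finite R" "card R \<le> 1000"
            using R Q fin card_mono[OF fin R(1)] by (auto intro: finite_subset)
          with good R(2) show "\<exists>\<phi> :: real ^ 2 \<Rightarrow> f3. \<not> \<phi> constant_on R \<and>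
              (\<forall>\<Delta>\<subseteq>R. card \<Delta> = 3 \<longrightarrow> ?H \<Delta> \<longrightarrow> (\<Sum>x\<in>\<Delta>. \<phi> x) = 0)" by blast
        qed
        then show "real (num_triples ?H Q) \<le> 0.25108 * real (1000 choose 3)"
          by (simp add: Q choose_1000_3)
      qed (use P that in auto)
      then show ?thesis using P by (simp add: num_similar_def num_triples_def)
    qed
    then have "\<forall>\<^sub>F n in sequentially. real (h n T \<epsilon>) \<le> 0.25108 * real (n choose 3) * (1 + 0)"
      by (auto intro: eventually_sequentiallyI[of 1000])
    moreover have "(\<lambda>_. 0 :: real) \<in> o(\<lambda>_ :: nat. 1 :: real)" by simp
    ultimately show "\<exists>\<epsilon>>0. (case T of (\<alpha>, \<beta>, \<gamma>) \<Rightarrow> \<epsilon> < \<alpha> \<and> \<epsilon> < \<beta> \<and> \<epsilon> < \<gamma>) \<and>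
        (\<exists>r :: nat \<Rightarrow> real. r \<in> o(\<lambda>_. 1) \<and>
           (\<forall>\<^sub>F n in sequentially. real (h n T \<epsilon>) \<le> 0.25108 * real (n choose 3) * (1 + r n)))"
      using \<epsilon> T by (intro exI[of _ \<epsilon>] conjI exI[of _ "\<lambda>_. 0"]) auto
  qed
qed

end
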